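(* Let $\varrho\in(-1,1)$, $\varrho\neq 0$. Gini's gamma of the bivariate normal copula with parameter $\varrho$, $$\gamma(\varrho):=4\left(\int_0^1 C(u,u;\varrho)\,du+\int_0^1 C(u,1-u;\varrho)\,du-\frac12\right),$$ is given by each of the following formulas: \begin{align*} \gamma(\varrho)&=\frac{2}{\pi}\left(\arcsin\left(\frac{1+\varrho}{2}\right)-\arcsin\left(\frac{1-\varrho}{2}\right)\right)\\ &=\frac{4}{\pi}\left(\arcsin\left(\frac{\sqrt{1+\varrho}}{2}\right)-\arcsin\left(\frac{\sqrt{1-\varrho}}{2}\right)\right)\\ &=\frac{4}{\pi}\arcsin\left(\frac14\left(\sqrt{(1+\varrho)(3+\varrho)}-\sqrt{(1-\varrho)(3-\varrho)}\right)\right). \end{align*}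
   Context: $\Phi$ is the standard normal distribution function. For $\varrho\in(-1,1)$, $$\varphi_2(x,y;\varrho)=\frac{1}{2\pi\sqrt{1-\varrho^2}}\exp\left(-\frac{x^2-2\varrho xy+y^2}{2(1-\varrho^2)}\right),\qquad \Phi_2(h,k;\varrho)=\int_{-\infty}^h\int_{-\infty}^k\varphi_2(x,y;\varrho)\,dy\,dx,$$ and the bivariate normal copula with parameter $\varrho$ is $C(u,v;\varrho)=\Phi_2(\Phi^{-1}(u),\Phi^{-1}(v);\varrho)$ for $u,v\in(0,1)$, extended continuously to $[0,1]^2$. *)

theory Defs
  imports "HOL-Probability.Probability"
begin

definition std_normal_cdf :: "real \<Rightarrow> real" where
  "std_normal_cdf = cdf std_normal_distribution"

definition bvn_density :: "real \<Rightarrow> real \<Rightarrow> real \<Rightarrow> real" where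
  "bvn_density \<rho> x y =
     1 / (2 * pi * sqrt (1 - \<rho>\<^sup>2)) *
     exp (- (x\<^sup>2 - 2 * \<rho> * x * y + y\<^sup>2) / (2 * (1 - \<rho>\<^sup>2)))"

definition bvn_cdf :: "real \<Rightarrow> real \<Rightarrow> real \<Rightarrow> real" where
  "bvn_cdf \<rho> h k = (LBINT x:{..h}. (LBINT y:{..k}. bvn_density \<rho> x y))"

(* std_normal_cdf is a bijection from the reals onto {0<..<1}, so its inverse below is
   the normal quantile function there; the copula uses it only on {0<..<1}. *)
definition bvn_copula_interior :: "real \<Rightarrow> real \<Rightarrow> real \<Rightarrow> real" where
  "bvn_copula_interior \<rho> u v =
     bvn_cdf \<rho> (inv std_normal_cdf u) (inv std_normal_cdf v)"

(* On the boundary of the unit square, the value is that of the continuous extension.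
   Values outside the closed square are irrelevant. *)
definition bvn_copula :: "real \<Rightarrow> real \<Rightarrow> real \<Rightarrow> real" where
  "bvn_copula \<rho> u v =
     (if u \<in> {0<..<1} \<and> v \<in> {0<..<1} then bvn_copula_interior \<rho> u v
      else Lim (at (u, v) within {0<..<1} \<times> {0<..<1})
             (\<lambda>(a, b). bvn_copula_interior \<rho> a b))"

definition gini_gamma :: "(real \<Rightarrow> real \<Rightarrow> real) \<Rightarrow> real" where
  "gini_gamma C =
     4 * ((LBINT u:{0..1}. C u u) + (LBINT u:{0..1}. C u (1 - u)) - 1 / 2)"

end

(*
  Substituting u = Phi(z), the two integrals in gamma are the Gaussian orthant probabilities
  P(X <= Z, Y <= eps * Z) for eps = 1 and eps = -1, where (X, Y) is bivariate normal with
  correlation rho and Z is an independent standard normal variable. Integrating out Y and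
  putting T = Z - X, the Gaussian density in (Z, T) splits by completing the square; as
  int phi(v) Phi(a + b v) dv = Phi(a / sqrt(1 + b^2)), this leaves
  int_{t > 0} phi(t) Phi(c t) dt = 1/4 + arctan(c) / (2 pi).
*)

theory Submission
  imports Defs
begin

section \<open>The standard normal distribution function as a nonnegative integral\<close>

lemma cdf_distribution_std_normal: "cdf_distribution std_normal_distribution"
  by (simp add: cdf_distribution_def real_dist_normal_dist)

lemma borel_measurable_std_normal_cdf [measurable]: "std_normal_cdf \<in> borel_measurable borel"
  unfolding std_normal_cdf_def
  by (rule cdf_distribution.measurable_C[OF cdf_distribution_std_normal])

lemma std_normal_cdf_bounds: "0 \<le> std_normal_cdf a" "std_normal_cdf a \<le> 1"
proof -
  interpret cdf_distribution std_normal_distribution by (rule cdf_distribution_std_normal)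
  show "0 \<le> std_normal_cdf a" "std_normal_cdf a \<le> 1"
    using cdf_nonneg cdf_bounded_prob by (auto simp: std_normal_cdf_def)
qed

text \<open>The form in which Phi enters all computations: with nonnegative integrals, substitution
  and the exchange of integrals by Tonelli reduce to measurability.\<close>

lemma ennreal_std_normal_cdf:
  "ennreal (std_normal_cdf a) = (\<integral>\<^sup>+y. ennreal (std_normal_density y) * indicator {..a} y \<partial>lborel)"
proof -
  interpret cdf_distribution std_normal_distribution by (rule cdf_distribution_std_normal)
  have "ennreal (std_normal_cdf a) = emeasure std_normal_distribution {..a}"
    by (simp add: std_normal_cdf_def cdf_def emeasure_eq_measure)
  then show ?thesis
    by (simp add: emeasure_density)
qed

lemma nn_integral_normal_density [simp]:
  assumes "0 < \<sigma>"
  shows "(\<integral>\<^sup>+x. ennreal (normal_density \<mu> \<sigma> x) \<partial>lborel) = 1"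
  using assms by (simp add: nn_integral_eq_integral)

lemma nn_integral_normal_density_affine:
  assumes "0 < \<sigma>" and [measurable]: "g \<in> borel_measurable borel"
  shows "(\<integral>\<^sup>+z. ennreal (normal_density \<mu> \<sigma> z) * g z \<partial>lborel)
       = (\<integral>\<^sup>+v. ennreal (std_normal_density v) * g (\<mu> + \<sigma> * v) \<partial>lborel)"
proof -
  have *: "\<sigma> * normal_density \<mu> \<sigma> (\<mu> + \<sigma> * v) = std_normal_density v" for v
    using assms(1) by (simp add: normal_density_def real_sqrt_mult power_mult_distrib)
  show ?thesis
    using assms(1)
    by (subst nn_integral_real_affine[where c=\<sigma> and t=\<mu>])
       (auto simp: nn_integral_cmult[symmetric] mult.assoc[symmetric] ennreal_mult'[symmetric] *)
qed

lemma nn_integral_normal_density_atMost: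
  assumes "0 < \<sigma>"
  shows "(\<integral>\<^sup>+y. ennreal (normal_density \<mu> \<sigma> y) * indicator {..a} y \<partial>lborel)
       = ennreal (std_normal_cdf ((a - \<mu>) / \<sigma>))"
proof -
  have "indicator {..a} (\<mu> + \<sigma> * v) = (indicator {..(a - \<mu>) / \<sigma>} v :: ennreal)" for v
    using assms by (auto simp: indicator_def field_simps)
  then show ?thesis
    using assms by (subst nn_integral_normal_density_affine) (auto simp: ennreal_std_normal_cdf)
qed

section \<open>Completing the square and Gaussian averages of Phi\<close>

text \<open>Completing the square in \<open>v\<close>. For independent standard normal V and W, put
  Y = W - bV: the left side is the joint density of (V, Y), the right side is the density of Y, with
  variance \<open>q\<^sup>2\<close>, times that of V given Y = y.\<close>

lemma std_normal_density_mult_affine: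
  fixes b :: real
  defines "q \<equiv> sqrt (1 + b\<^sup>2)"
  shows "std_normal_density v * std_normal_density (y + b * v)
       = normal_density 0 q y * normal_density (- (b * y) / q\<^sup>2) (1 / q) v"
proof -
  have q2: "q\<^sup>2 = 1 + b\<^sup>2" and q: "0 < q"
    unfolding q_def by (auto simp: add_pos_nonneg)
  have q4: "1 + b\<^sup>2 \<noteq> 0" using q q2 by (metis zero_less_power less_irrefl)
  have "- (v\<^sup>2 / 2) + - ((y + b * v)\<^sup>2 / 2)
      = - (y\<^sup>2 / (2 * (1 + b\<^sup>2))) + - ((v - - (b * y) / (1 + b\<^sup>2))\<^sup>2 * (1 + b\<^sup>2) / 2)"
    using q4 by (simp add: divide_simps) (simp add: power2_eq_square algebra_simps)
  then have E: "exp (- (v\<^sup>2 / 2)) * exp (- ((y + b * v)\<^sup>2 / 2))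
      = exp (- (y\<^sup>2 / (2 * (1 + b\<^sup>2)))) * exp (- ((v - - (b * y) / (1 + b\<^sup>2))\<^sup>2 * (1 + b\<^sup>2) / 2))"
    by (simp only: exp_add[symmetric])
  \<comment> \<open>The variances \<open>q\<^sup>2\<close> and \<open>1 / q\<^sup>2\<close> multiply
    to 1, so the normalising constants match those of two standard normals.\<close>
  have "sqrt (2 * pi * q\<^sup>2) * sqrt (2 * pi * (1 / q)\<^sup>2) = sqrt ((2 * pi)\<^sup>2)"
    using q by (simp add: real_sqrt_mult[symmetric] power2_eq_square)
  then have "sqrt (2 * pi * q\<^sup>2) * sqrt (2 * pi * (1 / q)\<^sup>2) = 2 * pi"
    by (simp add: real_sqrt_mult)
  then show ?thesis
    using E q unfolding normal_density_def
    by (simp add: q2 power_divide field_simps)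
qed

text \<open>Both sides are P(W - bV \<le> a) for independent standard normal V and W, and W - bV is
  centred normal with variance \<open>1 + b\<^sup>2\<close>.\<close>

lemma nn_integral_std_normal_cdf_affine:
  "(\<integral>\<^sup>+v. ennreal (std_normal_density v) * ennreal (std_normal_cdf (a + b * v)) \<partial>lborel)
   = ennreal (std_normal_cdf (a / sqrt (1 + b\<^sup>2)))"
proof -
  define q where "q = sqrt (1 + b\<^sup>2)"
  have q: "0 < q" unfolding q_def by (auto simp: add_pos_nonneg)
  \<comment> \<open>Translating by \<open>b * v\<close> moves \<open>v\<close> from the domain into
    the density, so the indicator survives the exchange of integrals unchanged.\<close>
  have shift: "ennreal (std_normal_cdf (a + b * v))
      = (\<integral>\<^sup>+y. ennreal (std_normal_density (y + b * v)) * indicator {..a} y \<partial>lborel)" for v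
  proof -
    have "indicator {..a + b * v} (b * v + y) = (indicator {..a} y :: ennreal)" for y
      by (auto simp: indicator_def)
    then show ?thesis
      unfolding ennreal_std_normal_cdf
      by (subst nn_integral_real_affine[where c=1 and t="b * v"]) (auto simp: add.commute)
  qed
  have "(\<integral>\<^sup>+v. ennreal (std_normal_density v) * ennreal (std_normal_cdf (a + b * v)) \<partial>lborel)
      = (\<integral>\<^sup>+v. \<integral>\<^sup>+y. ennreal (std_normal_density v * std_normal_density (y + b * v)) * indicator {..a} y \<partial>lborel \<partial>lborel)"
    by (simp add: shift nn_integral_cmult[symmetric] ennreal_mult mult.assoc)
  also have "\<dots> = (\<integral>\<^sup>+y. \<integral>\<^sup>+v. ennreal (std_normal_density v * std_normal_density (y + b * v)) * indicator {..a} y \<partial>lborel \<partial>lborel)"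
    by (rule lborel_pair.Fubini') measurable
  \<comment> \<open>After factoring, the conditional density of \<open>v\<close> integrates to
    1.\<close>
  also have "\<dots> = (\<integral>\<^sup>+y. ennreal (normal_density 0 q y) * indicator {..a} y \<partial>lborel)"
    using q unfolding std_normal_density_mult_affine q_def[symmetric]
    by (simp add: ennreal_mult nn_integral_multc nn_integral_cmult)
  also have "\<dots> = ennreal (std_normal_cdf (a / q))"
    using q by (simp add: nn_integral_normal_density_atMost)
  finally show ?thesis by (simp add: q_def)
qed

section \<open>The Gaussian measure of a sector\<close>

lemma nn_integral_arctan_atMost:
  "(\<integral>\<^sup>+m. ennreal (1 / (2 * pi * (1 + m\<^sup>2))) * indicator {..c} m \<partial>lborel)
   = ennreal (1 / 4 + arctan c / (2 * pi))"
proof -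
  have pos: "0 < 1 + m\<^sup>2" for m :: real by (simp add: add_pos_nonneg)
  have "(\<integral>\<^sup>+m. ennreal (1 / (2 * pi * (1 + m\<^sup>2))) * indicator {..c} m \<partial>lborel)
      = (\<integral>\<^sup>+m. ennreal (1 / (2 * pi * (1 + m\<^sup>2))) * indicator {- c..} m \<partial>lborel)"
    \<comment> \<open>The integrand is even; reflection gives a half-line unbounded above, as
      \<open>nn_integral_FTC_atLeast\<close> expects.\<close>
    by (subst nn_integral_real_affine[where c="-1" and t=0])
       (auto intro!: nn_integral_cong simp: indicator_def)
  also have "\<dots> = ennreal (1 / 4 - arctan (- c) / (2 * pi))"
  proof (rule nn_integral_FTC_atLeast)
    show "((\<lambda>m. arctan m / (2 * pi)) has_real_derivative 1 / (2 * pi * (1 + m\<^sup>2))) (at m)" for m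
      using DERIV_cdivide[OF DERIV_arctan[of m], of "2 * pi"] by (simp add: field_simps)
    have "((\<lambda>m. arctan m / (2 * pi)) \<longlongrightarrow> (pi / 2) / (2 * pi)) at_top"
      by (intro tendsto_intros tendsto_arctan_at_top) auto
    then show "((\<lambda>m. arctan m / (2 * pi)) \<longlongrightarrow> 1 / 4) at_top" by simp
  qed (use pos in \<open>auto simp: less_imp_le\<close>)
  finally show ?thesis by (simp add: arctan_minus)
qed

text \<open>The mass that the planar Gaussian on the half-plane t \<ge> 0 gives to slope
  \<open>m\<close>. The factor \<open>t\<close> is the Jacobian of (t, m) -> (t, mt), and it makes
  the integrand elementary: the antiderivative is \<open>G\<close> below.\<close>

lemma nn_integral_std_normal_density_mult_ray:
  "(\<integral>\<^sup>+t. ennreal (t * std_normal_density t * std_normal_density (m * t)) * indicator {0..} t \<partial>lborel)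
   = ennreal (1 / (2 * pi * (1 + m\<^sup>2)))"
proof -
  define k where "k = 1 + m\<^sup>2"
  have pos: "0 < k" by (simp add: k_def add_pos_nonneg)
  have eq: "t * std_normal_density t * std_normal_density (m * t)
      = t * exp (- (t\<^sup>2 * k / 2)) / (2 * pi)" for t
    by (simp add: k_def std_normal_density_def exp_add[symmetric] algebra_simps power_mult_distrib
        add_divide_distrib mult_exp_exp)
  define G where "G = (\<lambda>t. - (exp (- (t\<^sup>2 * k / 2)) / (2 * pi * k)))"
  have "(\<integral>\<^sup>+t. ennreal (t * std_normal_density t * std_normal_density (m * t)) * indicator {0..} t \<partial>lborel)
      = ennreal (0 - G 0)"
  proof (rule nn_integral_FTC_atLeast)
    show "(G has_real_derivative t * std_normal_density t * std_normal_density (m * t)) (at t)" for t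
      unfolding eq G_def using pos
      by (auto intro!: derivative_eq_intros simp: power2_eq_square)
    have "filterlim (\<lambda>t::real. t\<^sup>2 * (k / 2)) at_top at_top"
      using pos by (intro filterlim_at_top_mult_tendsto_pos[OF tendsto_const] filterlim_pow_at_top filterlim_ident) auto
    then have "((\<lambda>t::real. exp (- (t\<^sup>2 * (k / 2)))) \<longlongrightarrow> 0) at_top"
      by (intro filterlim_compose[OF exp_at_bot]) (simp add: filterlim_uminus_at_top)
    then have "((\<lambda>t. - (exp (- (t\<^sup>2 * (k / 2))) / (2 * pi * k))) \<longlongrightarrow> - (0 / (2 * pi * k))) at_top"
      using pos by (intro tendsto_intros) auto
    then show "(G \<longlongrightarrow> 0) at_top" by (simp add: G_def)
  qed auto
  then show ?thesis by (simp add: G_def k_def)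
qed

text \<open>The integral is the Gaussian measure of the sector t \<ge> 0, y \<le> ct. In the
  coordinates (t, m) with y = mt the sector becomes the product of t \<ge> 0 and m \<le> c, and
  integrating over \<open>t\<close> first leaves half of a Cauchy density in
  \<open>m\<close>.\<close>

lemma nn_integral_std_normal_cdf_ray:
  "(\<integral>\<^sup>+t. ennreal (std_normal_density t) * ennreal (std_normal_cdf (c * t)) * indicator {0..} t \<partial>lborel)
   = ennreal (1 / 4 + arctan c / (2 * pi))"
proof -
  have slope: "ennreal (std_normal_cdf (c * t))
      = (\<integral>\<^sup>+m. ennreal (t * std_normal_density (m * t)) * indicator {..c} m \<partial>lborel)" if "0 < t" for t
  proof -
    have "indicator {..c * t} (t * m) = (indicator {..c} m :: ennreal)" for m
      using that by (auto simp: indicator_def mult.commute)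
    then show ?thesis
      unfolding ennreal_std_normal_cdf using that
      by (subst nn_integral_real_affine[where c=t and t=0])
         (auto simp: nn_integral_cmult[symmetric] ennreal_mult mult_ac)
  qed
  have "(\<integral>\<^sup>+t. ennreal (std_normal_density t) * ennreal (std_normal_cdf (c * t)) * indicator {0..} t \<partial>lborel)
      = (\<integral>\<^sup>+t. \<integral>\<^sup>+m. ennreal (t * std_normal_density t * std_normal_density (m * t)) * indicator {0..} t
            * indicator {..c} m \<partial>lborel \<partial>lborel)"
  \<comment> \<open>At t = 0 the slope substitution degenerates: the left integrand is positive
    there and the right one is 0. Hence equality almost everywhere only.\<close>
  proof (intro nn_integral_cong_AE, use AE_lborel_singleton[of 0] in eventually_elim)
    fix t :: real assume "t \<noteq> 0"
    show "ennreal (std_normal_density t) * ennreal (std_normal_cdf (c * t)) * indicator {0..} t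
      = (\<integral>\<^sup>+m. ennreal (t * std_normal_density t * std_normal_density (m * t)) * indicator {0..} t
            * indicator {..c} m \<partial>lborel)"
    proof (cases "0 < t")
      case True
      then have "ennreal (t * std_normal_density t * std_normal_density (m * t))
          = ennreal (std_normal_density t) * ennreal (t * std_normal_density (m * t))" for m
        by (simp add: ennreal_mult[symmetric] mult_ac)
      with True show ?thesis
        by (simp add: slope nn_integral_cmult[symmetric] mult.assoc)
    qed (use \<open>t \<noteq> 0\<close> in simp)
  qed
  also have "\<dots> = (\<integral>\<^sup>+m. \<integral>\<^sup>+t. ennreal (t * std_normal_density t * std_normal_density (m * t)) * indicator {0..} t
            * indicator {..c} m \<partial>lborel \<partial>lborel)"
    by (rule lborel_pair.Fubini') measurable
  also have "\<dots> = (\<integral>\<^sup>+m. ennreal (1 / (2 * pi * (1 + m\<^sup>2))) * indicator {..c} m \<partial>lborel)"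
    by (simp add: nn_integral_multc nn_integral_std_normal_density_mult_ray)
  finally show ?thesis by (simp add: nn_integral_arctan_atMost)
qed


section \<open>The trivariate orthant probability\<close>

text \<open>This is P(X \<le> Z, W \<le> \<alpha>Z - \<beta>X) for independent standard normal X, Z,
  W. With T = Z - X the conditions read T \<ge> 0 and W \<le> \<beta>T + (\<alpha> - \<beta>)Z.
  Averaging over Z given T, then rescaling T to unit variance, leaves a sector of slope
  \<open>c\<close>.\<close>

lemma nn_integral_std_normal_half_plane:
  "(\<integral>\<^sup>+z. ennreal (std_normal_density z) *
      (\<integral>\<^sup>+x. ennreal (std_normal_density x) * ennreal (std_normal_cdf (\<alpha> * z - \<beta> * x)) * indicator {..z} x \<partial>lborel) \<partial>lborel)
   = ennreal (1 / 4 + arctan ((\<alpha> + \<beta>) / sqrt (2 + (\<alpha> - \<beta>)\<^sup>2)) / (2 * pi))"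
proof -
  define c where "c = (\<alpha> + \<beta>) / sqrt (2 + (\<alpha> - \<beta>)\<^sup>2)"
  let ?N = std_normal_density and ?F = "\<lambda>a. ennreal (std_normal_cdf a)"
  have refl: "(\<integral>\<^sup>+x. ennreal (?N x) * ?F (\<alpha> * z - \<beta> * x) * indicator {..z} x \<partial>lborel)
      = (\<integral>\<^sup>+t. ennreal (?N (t + (- 1) * z)) * ?F (\<beta> * t + (\<alpha> - \<beta>) * z) * indicator {0..} t \<partial>lborel)" for z
  proof -
    have "?N (z - t) = ?N (t - z)" for t
      by (simp add: normal_density_def power2_commute)
    then show ?thesis
      by (subst nn_integral_real_affine[where c="-1" and t=z])
         (auto intro!: nn_integral_cong simp: indicator_def algebra_simps)
  qed
  \<comment> \<open>The case b = -1: T has variance 2, and Z given T = t is normal with mean t/2 and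
    variance 1/2.\<close>
  have square: "?N z * ?N (t + (- 1) * z) = normal_density 0 (sqrt 2) t * normal_density (t / 2) (1 / sqrt 2) z" for z t
    using std_normal_density_mult_affine[of z t "-1"] by simp
  have slice: "(\<integral>\<^sup>+z. ennreal (normal_density (t / 2) (1 / sqrt 2) z) * ?F (\<beta> * t + (\<alpha> - \<beta>) * z) \<partial>lborel)
      = ?F (c * (t / sqrt 2))" for t
  proof -
    have "1 + ((\<alpha> - \<beta>) / sqrt 2)\<^sup>2 = (2 + (\<alpha> - \<beta>)\<^sup>2) / 2"
      by (simp add: power_divide field_simps)
    then have "sqrt (1 + ((\<alpha> - \<beta>) / sqrt 2)\<^sup>2) = sqrt (2 + (\<alpha> - \<beta>)\<^sup>2) / sqrt 2"
      by (simp only: real_sqrt_divide)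
    then have "((\<alpha> + \<beta>) * (t / 2)) / sqrt (1 + ((\<alpha> - \<beta>) / sqrt 2)\<^sup>2) = c * (t / 2 * sqrt 2)"
      by (simp add: c_def)
    also have "t / 2 * sqrt 2 = t / sqrt 2"
      by (simp add: field_simps)
    finally have c: "((\<alpha> + \<beta>) * (t / 2)) / sqrt (1 + ((\<alpha> - \<beta>) / sqrt 2)\<^sup>2) = c * (t / sqrt 2)" .
    \<comment> \<open>Substituting z = t/2 + v / sqrt 2 makes the argument of Phi affine in a
      standard normal \<open>v\<close>.\<close>
    have "(\<integral>\<^sup>+z. ennreal (normal_density (t / 2) (1 / sqrt 2) z) * ?F (\<beta> * t + (\<alpha> - \<beta>) * z) \<partial>lborel)
        = (\<integral>\<^sup>+v. ennreal (?N v) * ?F ((\<alpha> + \<beta>) * (t / 2) + (\<alpha> - \<beta>) / sqrt 2 * v) \<partial>lborel)"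
      by (subst nn_integral_normal_density_affine) (auto simp: field_simps)
    also have "\<dots> = ?F (c * (t / sqrt 2))"
      by (simp only: nn_integral_std_normal_cdf_affine c)
    finally show ?thesis .
  qed
  have "(\<integral>\<^sup>+z. ennreal (?N z) *
      (\<integral>\<^sup>+x. ennreal (?N x) * ?F (\<alpha> * z - \<beta> * x) * indicator {..z} x \<partial>lborel) \<partial>lborel)
      = (\<integral>\<^sup>+z. \<integral>\<^sup>+t. ennreal (?N z * ?N (t + (- 1) * z)) * ?F (\<beta> * t + (\<alpha> - \<beta>) * z) * indicator {0..} t \<partial>lborel \<partial>lborel)"
    unfolding refl by (simp add: nn_integral_cmult[symmetric] ennreal_mult mult.assoc)
  also have "\<dots> = (\<integral>\<^sup>+t. \<integral>\<^sup>+z. ennreal (?N z * ?N (t + (- 1) * z)) * ?F (\<beta> * t + (\<alpha> - \<beta>) * z) * indicator {0..} t \<partial>lborel \<partial>lborel)"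
    by (rule lborel_pair.Fubini') measurable
  also have "\<dots> = (\<integral>\<^sup>+t. ennreal (normal_density 0 (sqrt 2) t) * (?F (c * (t / sqrt 2)) * indicator {0..} t) \<partial>lborel)"
    unfolding square
    by (simp add: ennreal_mult nn_integral_multc nn_integral_cmult slice mult.assoc)
       (simp add: nn_integral_multc nn_integral_cmult slice mult.assoc[symmetric])
  also have "\<dots> = (\<integral>\<^sup>+t. ennreal (?N t) * ?F (c * t) * indicator {0..} t \<partial>lborel)"
    by (subst nn_integral_normal_density_affine) (auto intro!: nn_integral_cong simp: indicator_def zero_le_mult_iff)
  also have "\<dots> = ennreal (1 / 4 + arctan c / (2 * pi))"
    by (rule nn_integral_std_normal_cdf_ray)
  finally show ?thesis by (simp add: c_def)
qed

section \<open>The bivariate normal distribution function along lines through the origin\<close>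

text \<open>Marginal times conditional density: X is standard normal, and Y given X = x is normal
  with mean \<open>\<rho> * x\<close> and variance \<open>1 - \<rho>\<^sup>2\<close>.\<close>

lemma bvn_density_eq_normal_density:
  assumes "\<bar>\<rho>\<bar> < 1"
  shows "bvn_density \<rho> x y = std_normal_density x * normal_density (\<rho> * x) (sqrt (1 - \<rho>\<^sup>2)) y"
proof -
  have pos: "0 < 1 - \<rho>\<^sup>2" using assms by (simp add: abs_square_less_1)
  have "- (x\<^sup>2 - 2 * \<rho> * x * y + y\<^sup>2) / (2 * (1 - \<rho>\<^sup>2))
      = - x\<^sup>2 / 2 + - (y - \<rho> * x)\<^sup>2 / (2 * (1 - \<rho>\<^sup>2))"
    using pos by (simp add: divide_simps) (simp add: power2_eq_square algebra_simps)
  then have E: "exp (- (x\<^sup>2 - 2 * \<rho> * x * y + y\<^sup>2) / (2 * (1 - \<rho>\<^sup>2)))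
      = exp (- x\<^sup>2 / 2) * exp (- (y - \<rho> * x)\<^sup>2 / (2 * (1 - \<rho>\<^sup>2)))"
    by (simp only: exp_add)
  have "sqrt (2 * pi) * sqrt (2 * pi * (1 - \<rho>\<^sup>2)) = sqrt ((2 * pi)\<^sup>2 * (1 - \<rho>\<^sup>2))"
    by (simp add: real_sqrt_mult[symmetric] power2_eq_square mult_ac)
  then have "sqrt (2 * pi) * sqrt (2 * pi * (1 - \<rho>\<^sup>2)) = 2 * pi * sqrt (1 - \<rho>\<^sup>2)"
    by (simp add: real_sqrt_mult)
  then show ?thesis
    unfolding bvn_density_def E normal_density_def using pos by simp
qed

lemma ennreal_bvn_cdf:
  assumes "\<bar>\<rho>\<bar> < 1"
  shows "ennreal (bvn_cdf \<rho> h k) = (\<integral>\<^sup>+x. ennreal (std_normal_density x)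
      * ennreal (std_normal_cdf ((k - \<rho> * x) / sqrt (1 - \<rho>\<^sup>2))) * indicator {..h} x \<partial>lborel)"
    (is "_ = ?R")
proof -
  define s where "s = sqrt (1 - \<rho>\<^sup>2)"
  have s: "0 < s" using assms by (simp add: s_def abs_square_less_1)
  have inner: "(LBINT y:{..k}. bvn_density \<rho> x y) = std_normal_density x * std_normal_cdf ((k - \<rho> * x) / s)" for x
  proof -
    have "(LBINT y:{..k}. normal_density (\<rho> * x) s y)
        = enn2real (\<integral>\<^sup>+y. ennreal (normal_density (\<rho> * x) s y) * indicator {..k} y \<partial>lborel)"
      unfolding set_lebesgue_integral_def
      by (subst integral_eq_nn_integral) (auto simp: ennreal_mult mult.commute ennreal_indicator)
    then show ?thesis
      using s std_normal_cdf_bounds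
      by (simp add: bvn_density_eq_normal_density[OF assms] s_def[symmetric] nn_integral_normal_density_atMost)
  qed
  \<comment> \<open>Finiteness allows the passage back from \<open>enn2real ?R\<close> to
    \<open>?R\<close>; without it an infinite integral would be read as 0.\<close>
  have "?R \<le> (\<integral>\<^sup>+x. ennreal (std_normal_density x) \<partial>lborel)"
  proof (rule nn_integral_mono)
    fix x :: real
    have "ennreal (std_normal_cdf a) \<le> 1" for a
      using std_normal_cdf_bounds(2)[of a] by simp
    then show "ennreal (std_normal_density x) * ennreal (std_normal_cdf ((k - \<rho> * x) / sqrt (1 - \<rho>\<^sup>2)))
        * indicator {..h} x \<le> ennreal (std_normal_density x)"
      by (auto simp: indicator_def intro!: mult_left_le)
  qed
  then have fin: "?R < \<top>" by (simp add: le_less_trans)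
  have "bvn_cdf \<rho> h k = enn2real ?R"
    unfolding bvn_cdf_def inner unfolding set_lebesgue_integral_def s_def[symmetric]
    using std_normal_cdf_bounds
    by (subst integral_eq_nn_integral)
       (auto simp: ennreal_mult ennreal_indicator mult_ac intro!: arg_cong[where f=enn2real] nn_integral_cong)
  with fin show ?thesis by simp
qed

lemma bvn_cdf_nonneg: "\<bar>\<rho>\<bar> < 1 \<Longrightarrow> 0 \<le> bvn_cdf \<rho> h k"
  unfolding bvn_cdf_def set_lebesgue_integral_def
  by (intro integral_nonneg_AE AE_I2 mult_nonneg_nonneg scaleR_nonneg_nonneg)
     (auto simp: bvn_density_eq_normal_density)

lemma borel_measurable_bvn_cdf:
  assumes "\<bar>\<rho>\<bar> < 1"
  shows "(\<lambda>z. bvn_cdf \<rho> z (\<epsilon> * z)) \<in> borel_measurable borel"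
proof -
  have "bvn_cdf \<rho> z (\<epsilon> * z) = enn2real (\<integral>\<^sup>+x. ennreal (std_normal_density x)
      * ennreal (std_normal_cdf ((\<epsilon> * z - \<rho> * x) / sqrt (1 - \<rho>\<^sup>2))) * indicator {..z} x \<partial>lborel)" for z
    using assms by (simp add: ennreal_bvn_cdf[symmetric] bvn_cdf_nonneg)
  then show ?thesis
    \<comment> \<open>The set \<open>{..z}\<close> depends on the parameter; written as the
      comparison x \<le> z, it is visibly measurable jointly in \<open>x\<close> and
      \<open>z\<close>.\<close>
    by (simp only: indicator_def atMost_iff of_bool_def) measurable
qed

text \<open>P(X \<le> Z, Y \<le> \<epsilon>Z) with Z independent of (X, Y). Conditioning on X and Z
  gives the half-plane integral with \<alpha> = \<open>\<epsilon> / s\<close> and \<beta> =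
  \<open>\<rho> / s\<close>; multiplying numerator and root by \<open>s\<close> yields the stated
  slope.\<close>

lemma integral_bvn_cdf_line:
  assumes "\<bar>\<rho>\<bar> < 1"
  shows "(\<integral>z. bvn_cdf \<rho> z (\<epsilon> * z) \<partial>std_normal_distribution)
       = 1 / 4 + arctan ((\<epsilon> + \<rho>) / sqrt (2 * (1 - \<rho>\<^sup>2) + (\<epsilon> - \<rho>)\<^sup>2)) / (2 * pi)"
proof -
  define s where "s = sqrt (1 - \<rho>\<^sup>2)"
  have s: "0 < s" and s2: "s\<^sup>2 = 1 - \<rho>\<^sup>2"
    using assms by (auto simp: s_def abs_square_less_1 abs_square_le_1)
  note [measurable] = borel_measurable_bvn_cdf[OF assms]
  have sq: "2 + (\<epsilon> / s - \<rho> / s)\<^sup>2 = (2 * s\<^sup>2 + (\<epsilon> - \<rho>)\<^sup>2) / s\<^sup>2"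
    using s by (simp add: diff_divide_distrib[symmetric] power_divide add_divide_distrib)
  have c: "(\<epsilon> / s + \<rho> / s) / sqrt (2 + (\<epsilon> / s - \<rho> / s)\<^sup>2)
      = (\<epsilon> + \<rho>) / sqrt (2 * (1 - \<rho>\<^sup>2) + (\<epsilon> - \<rho>)\<^sup>2)"
    unfolding sq s2[symmetric] using s
    by (simp add: real_sqrt_divide add_divide_distrib[symmetric])
  \<comment> \<open>Nonnegativity lets the value survive the round trip through
    \<open>ennreal\<close>.\<close>
  have a: "0 \<le> 1 / 4 + arctan x / (2 * pi)" for x
    using arctan_bounded[of x] by (simp add: field_simps)
  have "(\<integral>\<^sup>+z. ennreal (bvn_cdf \<rho> z (\<epsilon> * z)) \<partial>std_normal_distribution)
      = (\<integral>\<^sup>+z. ennreal (std_normal_density z) * ennreal (bvn_cdf \<rho> z (\<epsilon> * z)) \<partial>lborel)"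
    by (rule nn_integral_density) measurable
  also have "\<dots> = ennreal (1 / 4 + arctan ((\<epsilon> + \<rho>) / sqrt (2 * (1 - \<rho>\<^sup>2) + (\<epsilon> - \<rho>)\<^sup>2)) / (2 * pi))"
    unfolding ennreal_bvn_cdf[OF assms] c[symmetric] s_def[symmetric]
    by (subst nn_integral_std_normal_half_plane[symmetric]) (simp add: diff_divide_distrib)
  finally show ?thesis
    using assms a by (subst integral_eq_nn_integral) (auto simp: bvn_cdf_nonneg)
qed


section \<open>The normal quantile function and the substitution u = Phi(z)\<close>

text \<open>The density is positive everywhere, so every nonempty interval \<open>{x<..y}\<close>
  has positive mass.\<close>

lemma strict_mono_std_normal_cdf: "strict_mono std_normal_cdf"
proof (rule strict_monoI)
  fix x y :: real assume "x < y"
  interpret cdf_distribution std_normal_distribution by (rule cdf_distribution_std_normal)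
  have "emeasure std_normal_distribution {x<..y} \<noteq> 0"
  proof
    assume "emeasure std_normal_distribution {x<..y} = 0"
    then have "(\<integral>\<^sup>+t. ennreal (std_normal_density t) * indicator {x<..y} t \<partial>lborel) = 0"
      by (simp add: emeasure_density)
    then have "AE t in lborel. ennreal (std_normal_density t) * indicator {x<..y} t = 0"
      by (subst (asm) nn_integral_0_iff_AE) auto
    then have "AE t in lborel. t \<notin> {x<..y}"
    proof eventually_elim
      fix t :: real
      assume "ennreal (std_normal_density t) * indicator {x<..y} t = 0"
      then show "t \<notin> {x<..y}"
        using normal_density_pos[of 1 0 t] by (auto simp: indicator_def split: if_splits)
    qed
    then have "emeasure lborel {x<..y} = 0"
      by (subst (asm) AE_iff_measurable[where N="{x<..y}"]) auto
    with \<open>x < y\<close> show False by simp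
  qed
  then have "0 < measure std_normal_distribution {x<..y}"
    by (simp add: emeasure_eq_measure zero_less_measure_iff)
  then show "std_normal_cdf x < std_normal_cdf y"
    using cdf_diff_eq[OF \<open>x < y\<close>] by (simp add: std_normal_cdf_def)
qed

lemma isCont_std_normal_cdf: "isCont std_normal_cdf x"
proof -
  interpret cdf_distribution std_normal_distribution by (rule cdf_distribution_std_normal)
  have "emeasure std_normal_distribution {x} = 0"
    by (simp add: emeasure_density nn_integral_null_set null_setsI)
  then show ?thesis
    by (simp add: std_normal_cdf_def isCont_cdf measure_def)
qed

lemma std_normal_cdf_surj:
  assumes "0 < u" "u < 1"
  obtains x where "std_normal_cdf x = u"
proof -
  interpret cdf_distribution std_normal_distribution by (rule cdf_distribution_std_normal)
  \<comment> \<open>The limits 0 and 1 of Phi at the two infinities supply the end points for the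
    intermediate value theorem.\<close>
  obtain a where a: "std_normal_cdf a < u"
    using eventually_happens'[OF trivial_limit_at_bot_linorder order_tendstoD(2)[OF bot assms(1)]]
    by (auto simp: std_normal_cdf_def)
  obtain b where b: "u < std_normal_cdf b"
    using eventually_happens'[OF trivial_limit_at_top_linorder order_tendstoD(1)[OF top assms(2)]]
    by (auto simp: std_normal_cdf_def)
  have "a \<le> b"
    using a b strict_mono_less_eq[OF strict_mono_std_normal_cdf, of b a] by linarith
  then obtain x where "std_normal_cdf x = u"
    using IVT[of std_normal_cdf a u b] a b isCont_std_normal_cdf by (auto simp: less_imp_le)
  then show thesis by (rule that)
qed

lemma inv_std_normal_cdf [simp]: "inv std_normal_cdf (std_normal_cdf x) = x"
  by (rule inv_f_f[OF strict_mono_imp_inj_on[OF strict_mono_std_normal_cdf]])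

text \<open>The density is even, so Phi(-x) is the mass of \<open>{x..}\<close>, which together with
  \<open>{..x}\<close> covers the line and overlaps it only in the null set
  \<open>{x}\<close>.\<close>

lemma std_normal_cdf_minus: "std_normal_cdf (- x) = 1 - std_normal_cdf x"
proof -
  have "ennreal (std_normal_cdf (- x)) = (\<integral>\<^sup>+y. ennreal (std_normal_density y) * indicator {x..} y \<partial>lborel)"
    unfolding ennreal_std_normal_cdf
    by (subst nn_integral_real_affine[where c="-1" and t=0])
       (auto intro!: nn_integral_cong simp: indicator_def normal_density_def)
  then have "ennreal (std_normal_cdf x + std_normal_cdf (- x))
      = (\<integral>\<^sup>+y. ennreal (std_normal_density y) * indicator {..x} y \<partial>lborel)
        + (\<integral>\<^sup>+y. ennreal (std_normal_density y) * indicator {x..} y \<partial>lborel)"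
    by (simp add: std_normal_cdf_bounds ennreal_std_normal_cdf[symmetric])
  also have "\<dots> = (\<integral>\<^sup>+y. ennreal (std_normal_density y) * indicator {..x} y
        + ennreal (std_normal_density y) * indicator {x..} y \<partial>lborel)"
    by (rule nn_integral_add[symmetric]) auto
  also have "\<dots> = (\<integral>\<^sup>+y. ennreal (std_normal_density y) \<partial>lborel)"
    by (intro nn_integral_cong_AE, use AE_lborel_singleton[of x] in eventually_elim)
       (auto simp: indicator_def)
  finally have "ennreal (std_normal_cdf x + std_normal_cdf (- x)) = ennreal 1"
    by simp
  then have "std_normal_cdf x + std_normal_cdf (- x) = 1"
    by (subst (asm) ennreal_inj) (auto simp: std_normal_cdf_bounds)
  then show ?thesis by simp
qed

lemma inv_std_normal_cdf_one_minus:
  assumes "0 < u" "u < 1"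
  shows "inv std_normal_cdf (1 - u) = - inv std_normal_cdf u"
proof -
  obtain x where x: "std_normal_cdf x = u" using std_normal_cdf_surj[OF assms] .
  then have "1 - u = std_normal_cdf (- x)" by (simp add: std_normal_cdf_minus)
  then have "inv std_normal_cdf (1 - u) = - x" by simp
  with x show ?thesis by auto
qed

text \<open>Inverse transform sampling: the quantile function carries the uniform distribution on
  (0, 1) to the standard normal one.\<close>

lemma set_integral_quantile:
  fixes h :: "real \<Rightarrow> real"
  assumes [measurable]: "h \<in> borel_measurable borel"
  shows "(LBINT u:{0<..<1}. h (inv std_normal_cdf u)) = (\<integral>z. h z \<partial>std_normal_distribution)"
proof -
  interpret cdf_distribution std_normal_distribution by (rule cdf_distribution_std_normal)
  \<comment> \<open>\<open>I\<close> is the generalised inverse of the distribution function,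
    characterised by: \<open>I u\<close> \<le> y iff u \<le> Phi(y). As Phi is strictly increasing,
    this determines the true preimage.\<close>
  have I_eq: "I u = inv std_normal_cdf u" if u: "0 < u" "u < 1" for u
  proof -
    obtain x where x: "std_normal_cdf x = u" using std_normal_cdf_surj[OF u] .
    have "I u \<le> y \<longleftrightarrow> x \<le> y" for y
      using pseudoinverse[OF u, of y] strict_mono_less_eq[OF strict_mono_std_normal_cdf, of x y] x
      by (simp add: std_normal_cdf_def)
    then have "I u = x" by (metis order_antisym order_refl)
    with x show ?thesis by auto
  qed
  have [measurable]: "I \<in> borel_measurable (restrict_space lborel {0<..<1})"
    using measurable_CI by (simp cong: measurable_cong_sets)
  have "(\<integral>z. h z \<partial>std_normal_distribution) = (\<integral>u. h (I u) \<partial>restrict_space lborel {0<..<1})"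
    by (subst distr_I_eq_M[symmetric], rule integral_distr) measurable
  also have "\<dots> = (LBINT u:{0<..<1}. h (I u))"
    by (simp add: integral_restrict_space set_lebesgue_integral_def)
  also have "\<dots> = (LBINT u:{0<..<1}. h (inv std_normal_cdf u))"
    by (rule set_lebesgue_integral_cong) (auto simp: I_eq)
  finally show ?thesis by simp
qed

text \<open>Covers both integrals of gamma: \<open>g u = u\<close> with \<epsilon> = 1, and
  \<open>g u = 1 - u\<close> with \<epsilon> = -1.\<close>

lemma set_integral_copula_line:
  assumes "\<bar>\<rho>\<bar> < 1"
    and "\<And>u. 0 < u \<Longrightarrow> u < 1 \<Longrightarrow> 0 < g u \<and> g u < 1 \<and> inv std_normal_cdf (g u) = \<epsilon> * inv std_normal_cdf u"
  shows "(LBINT u:{0..1}. bvn_copula \<rho> u (g u))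
       = 1 / 4 + arctan ((\<epsilon> + \<rho>) / sqrt (2 * (1 - \<rho>\<^sup>2) + (\<epsilon> - \<rho>)\<^sup>2)) / (2 * pi)"
proof -
  have "(LBINT u:{0..1}. bvn_copula \<rho> u (g u))
      = (LBINT u:{0<..<1}. bvn_cdf \<rho> (inv std_normal_cdf u) (\<epsilon> * inv std_normal_cdf u))"
    unfolding set_lebesgue_integral_def
  \<comment> \<open>The two end points form a null set; at all other points of the interval
    \<open>bvn_copula\<close> is given by \<open>bvn_cdf\<close> at the quantiles.\<close>
  proof (rule integral_discrete_difference[where X="{0, 1}"])
    fix u :: real assume "u \<notin> {0, 1}"
    then show "indicator {0..1} u *\<^sub>R bvn_copula \<rho> u (g u)
        = indicator {0<..<1} u *\<^sub>R bvn_cdf \<rho> (inv std_normal_cdf u) (\<epsilon> * inv std_normal_cdf u)"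
      using assms(2)[of u] by (auto simp: indicator_def bvn_copula_def bvn_copula_interior_def)
  qed auto
  also have "\<dots> = (\<integral>z. bvn_cdf \<rho> z (\<epsilon> * z) \<partial>std_normal_distribution)"
    by (rule set_integral_quantile[OF borel_measurable_bvn_cdf[OF assms(1)]])
  finally show ?thesis by (simp add: integral_bvn_cdf_line[OF assms(1)])
qed

section \<open>Trigonometric identities between the closed forms\<close>

lemma arctan_eq_arcsin:
  assumes "\<bar>x\<bar> < 1"
  shows "arctan (x / sqrt (1 - x\<^sup>2)) = arcsin x"
proof -
  have pos: "0 < 1 - x\<^sup>2" using assms by (simp add: abs_square_less_1)
  have b: "- (pi / 2) < arcsin x" "arcsin x < pi / 2"
    using arcsin_lt_bounded[of x] assms by auto
  have "tan (arcsin x) = x / sqrt (1 - x\<^sup>2)"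
    using assms by (simp add: tan_def sin_arcsin cos_arcsin)
  then show ?thesis
    using arctan_tan[OF b] by simp
qed

text \<open>For the angle \<open>a\<close> with sine \<open>sqrt x / 2\<close>, cos 2a = 1 - x/2 by
  the double angle formula. As \<open>a\<close> lies in [0, pi/2], pi/2 - 2a stays in the range of
  arcsin.\<close>

lemma arcsin_half_sqrt_double:
  assumes "0 \<le> x" "x \<le> 2"
  shows "2 * arcsin (sqrt x / 2) = pi / 2 - arcsin (1 - x / 2)"
proof -
  define a where "a = arcsin (sqrt x / 2)"
  have "sqrt x \<le> 2" using assms by (intro real_le_lsqrt) auto
  then have s: "0 \<le> sqrt x / 2" "- 1 \<le> sqrt x / 2" "sqrt x / 2 \<le> 1" using assms by (auto intro: order_trans[of _ 0])
  have sa: "sin a = sqrt x / 2" using s by (simp add: a_def sin_arcsin)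
  have a: "0 \<le> a" "a \<le> pi / 2"
    using s arcsin_le_arcsin[of 0 "sqrt x / 2"] arcsin_bounded[of "sqrt x / 2"] by (auto simp: a_def)
  have "sin (pi / 2 - 2 * a) = 1 - x / 2"
    using assms by (simp add: sin_diff cos_double_sin sa power_divide)
  then have "arcsin (1 - x / 2) = pi / 2 - 2 * a"
    using a arcsin_sin[of "pi / 2 - 2 * a"] by simp
  then show ?thesis by (simp add: a_def)
qed

text \<open>The subtraction formula for the sine. Both angles lie in [0, pi/2], so their difference
  is in the range of arcsin; their cosines are \<open>sqrt (3 - \<rho>) / 2\<close> and
  \<open>sqrt (3 + \<rho>) / 2\<close>.\<close>

lemma arcsin_half_sqrt_diff:
  assumes "- 1 \<le> \<rho>" "\<rho> \<le> 1"
  shows "arcsin (sqrt (1 + \<rho>) / 2) - arcsin (sqrt (1 - \<rho>) / 2)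
       = arcsin (1 / 4 * (sqrt ((1 + \<rho>) * (3 + \<rho>)) - sqrt ((1 - \<rho>) * (3 - \<rho>))))"
proof -
  let ?a = "arcsin (sqrt (1 + \<rho>) / 2)" and ?b = "arcsin (sqrt (1 - \<rho>) / 2)"
  have le2: "sqrt (1 + \<rho>) \<le> 2" "sqrt (1 - \<rho>) \<le> 2"
    using assms by (auto intro!: real_le_lsqrt)
  have nn: "0 \<le> sqrt (1 + \<rho>)" "0 \<le> sqrt (1 - \<rho>)"
    using assms by auto
  then have m2: "- 2 \<le> sqrt (1 + \<rho>)" "- 2 \<le> sqrt (1 - \<rho>)"
    by linarith+
  have "0 \<le> ?a" "0 \<le> ?b" "?a \<le> pi / 2" "?b \<le> pi / 2"
    using le2 nn m2 arcsin_le_arcsin[of 0 "sqrt (1 + \<rho>) / 2"] arcsin_le_arcsin[of 0 "sqrt (1 - \<rho>) / 2"]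
      arcsin_bounded[of "sqrt (1 + \<rho>) / 2"] arcsin_bounded[of "sqrt (1 - \<rho>) / 2"] by auto
  then have "arcsin (sin (?a - ?b)) = ?a - ?b"
    by (intro arcsin_sin) auto
  moreover have "cos ?a = sqrt (3 - \<rho>) / 2"
  proof -
    have "1 - (sqrt (1 + \<rho>) / 2)\<^sup>2 = (3 - \<rho>) / 2\<^sup>2"
      using assms by (simp add: power_divide field_simps)
    then have "sqrt (1 - (sqrt (1 + \<rho>) / 2)\<^sup>2) = sqrt (3 - \<rho>) / 2"
      by (simp only: real_sqrt_divide) simp
    then show ?thesis
      using le2 m2 by (subst cos_arcsin) auto
  qed
  moreover have "cos ?b = sqrt (3 + \<rho>) / 2"
  proof -
    have "1 - (sqrt (1 - \<rho>) / 2)\<^sup>2 = (3 + \<rho>) / 2\<^sup>2"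
      using assms by (simp add: power_divide field_simps)
    then have "sqrt (1 - (sqrt (1 - \<rho>) / 2)\<^sup>2) = sqrt (3 + \<rho>) / 2"
      by (simp only: real_sqrt_divide) simp
    then show ?thesis
      using le2 m2 by (subst cos_arcsin) auto
  qed
  ultimately show ?thesis
    using le2 m2 by (simp add: sin_diff sin_arcsin real_sqrt_mult mult.commute diff_divide_distrib)
qed

theorem mainTheorem2:
  fixes \<rho> :: real
  assumes "\<rho> \<in> {-1<..<1}" and "\<rho> \<noteq> 0"
  shows "gini_gamma (bvn_copula \<rho>) =
           2 / pi * (arcsin ((1 + \<rho>) / 2) - arcsin ((1 - \<rho>) / 2))
       \<and> gini_gamma (bvn_copula \<rho>) =
           4 / pi * (arcsin (sqrt (1 + \<rho>) / 2) - arcsin (sqrt (1 - \<rho>) / 2))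
       \<and> gini_gamma (bvn_copula \<rho>) =
           4 / pi * arcsin (1 / 4 * (sqrt ((1 + \<rho>) * (3 + \<rho>)) - sqrt ((1 - \<rho>) * (3 - \<rho>))))"
proof -
  have r: "\<bar>\<rho>\<bar> < 1" using assms by auto
  \<comment> \<open>When \<open>\<epsilon>\<^sup>2 = 1\<close>, the radicand equals
    \<open>4 - (\<epsilon> + \<rho>)\<^sup>2\<close>, so the arctangent is the angle with sine
    (\<epsilon> + \<rho>)/2.\<close>
  have arcsin_form: "arctan ((\<epsilon> + \<rho>) / sqrt (2 * (1 - \<rho>\<^sup>2) + (\<epsilon> - \<rho>)\<^sup>2)) = arcsin ((\<epsilon> + \<rho>) / 2)"
    if "\<bar>\<epsilon>\<bar> = 1" for \<epsilon>
  proof -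
    have e2: "\<epsilon>\<^sup>2 = 1" using that by (simp add: power2_eq_1_iff) linarith
    then have "2 * (1 - \<rho>\<^sup>2) + (\<epsilon> - \<rho>)\<^sup>2 = 2\<^sup>2 * (1 - ((\<epsilon> + \<rho>) / 2)\<^sup>2)"
      by (simp add: power2_sum power2_diff power_divide field_simps)
    then have "sqrt (2 * (1 - \<rho>\<^sup>2) + (\<epsilon> - \<rho>)\<^sup>2) = 2 * sqrt (1 - ((\<epsilon> + \<rho>) / 2)\<^sup>2)"
      by (simp only: real_sqrt_mult real_sqrt_abs)
    then have "(\<epsilon> + \<rho>) / sqrt (2 * (1 - \<rho>\<^sup>2) + (\<epsilon> - \<rho>)\<^sup>2) = (\<epsilon> + \<rho>) / 2 / sqrt (1 - ((\<epsilon> + \<rho>) / 2)\<^sup>2)"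
      by simp
    moreover have "\<bar>(\<epsilon> + \<rho>) / 2\<bar> < 1"
      using that r by simp
    ultimately show ?thesis
      by (simp only: arctan_eq_arcsin)
  qed
  have "(LBINT u:{0..1}. bvn_copula \<rho> u u) = 1 / 4 + arcsin ((1 + \<rho>) / 2) / (2 * pi)"
    using set_integral_copula_line[OF r, of "\<lambda>u. u" 1] arcsin_form[of 1] by simp
  moreover have "(LBINT u:{0..1}. bvn_copula \<rho> u (1 - u)) = 1 / 4 + arcsin ((- 1 + \<rho>) / 2) / (2 * pi)"
    using set_integral_copula_line[OF r, of "\<lambda>u. 1 - u" "- 1"] arcsin_form[of "- 1"]
    by (simp add: inv_std_normal_cdf_one_minus)
  moreover have "arcsin ((- 1 + \<rho>) / 2) = - arcsin ((1 - \<rho>) / 2)"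
    using arcsin_minus[of "(1 - \<rho>) / 2"] r by (simp add: minus_divide_left)
  \<comment> \<open>The two terms 1/4 cancel the 1/2 in the definition, and 4 / (2 pi) gives the
    factor 2 / pi.\<close>
  ultimately have 1: "gini_gamma (bvn_copula \<rho>) = 2 / pi * (arcsin ((1 + \<rho>) / 2) - arcsin ((1 - \<rho>) / 2))"
    by (simp add: gini_gamma_def field_simps)
  \<comment> \<open>Taking x = 1 + \<rho> and x = 1 - \<rho> swaps the signs in 1 - x/2; the terms
    pi/2 cancel in the difference.\<close>
  have "2 * arcsin (sqrt (1 + \<rho>) / 2) = pi / 2 - arcsin ((1 - \<rho>) / 2)"
    "2 * arcsin (sqrt (1 - \<rho>) / 2) = pi / 2 - arcsin ((1 + \<rho>) / 2)"
    using arcsin_half_sqrt_double[of "1 + \<rho>"] arcsin_half_sqrt_double[of "1 - \<rho>"] r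
    by (simp_all add: diff_divide_distrib add_divide_distrib)
  then have "arcsin ((1 + \<rho>) / 2) - arcsin ((1 - \<rho>) / 2)
      = 2 * (arcsin (sqrt (1 + \<rho>) / 2) - arcsin (sqrt (1 - \<rho>) / 2))"
    by (simp add: algebra_simps)
  with 1 have 2: "gini_gamma (bvn_copula \<rho>) = 4 / pi * (arcsin (sqrt (1 + \<rho>) / 2) - arcsin (sqrt (1 - \<rho>) / 2))"
    by simp
  with 1 arcsin_half_sqrt_diff[of \<rho>] r show ?thesis
    by simp
qed

end
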